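(* Let $M$ be a matroid on a finite ground set $E$, let $\mathbf{w}:E\to\mathbb{N}$ and $\ell:E\to\mathbb{N}$, where $\mathbb{N}=\{1,2,3,\dots\}$. If $M$ is $\mathbf{w}$-colorable from the lists $L(e)=\{1,2,\dots,\ell(e)\}$, $e\in E$, then $M$ is on-line $(\mathbf{w},\ell)$-colorable.
   Context: Colors are elements of $\mathbb{N}=\{1,2,3,\dots\}$. A $\mathbf{w}$-coloring of $M$ is a function $W:E\to\mathcal{P}(\mathbb{N})$ with $|W(e)|=\mathbf{w}(e)$ for every $e$, such that every coloring $c$ with $c(e)\in W(e)$ for all $e$ is proper (i.e. for each color $j$, the set $\{e: j\in W(e)\}$ is independent in $M$). $M$ is $\mathbf{w}$-colorable from lists $L:E\to\mathcal{P}(\mathbb{N})$ if there is a $\mathbf{w}$-coloring $W$ with $W(e)\subseteq L(e)$ for all $e\in E$. The on-line $(\mathbf{w},\ell)$ game: in round $i=1,2,\dots$, Bob chooses a non-empty set $B_i\subseteq E$ of elements whose lists currently contain fewer than $\ell(e)$ colors and inserts color $i$ into the lists of all elements of $B_i$; then Alice chooses an independent set $A_i\subseteq B_i$ and assigns color $i$ to its elements (she may assign to an element $e$ at most $\mathbf{w}(e)$ colors in total). The game ends when every element $e$ has exactly $\ell(e)$ colors in its list. Alice wins if at the end every element $e$ has been assigned $\mathbf{w}(e)$ colors (so that the assigned color sets form a $\mathbf{w}$-coloring from the lists). $M$ is on-line $(\mathbf{w},\ell)$-colorable if Alice has a winning strategy. *)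

theory Defs
  imports Main
begin

locale matroid =
  fixes E :: "'a set" and indep :: "'a set \<Rightarrow> bool"
  assumes finite_ground: "finite E"
    and indep_subset_ground: "indep X \<Longrightarrow> X \<subseteq> E"
    and indep_empty: "indep {}"
    and indep_subset: "indep X \<Longrightarrow> Y \<subseteq> X \<Longrightarrow> indep Y"
    and augmentation:
      "indep X \<Longrightarrow> indep Y \<Longrightarrow> card X < card Y \<Longrightarrow> \<exists>e\<in>Y - X. indep (insert e X)"

text \<open>Colors are the positive natural numbers. Only the values of weights, lists and colorings
  on the ground set \<open>E\<close> matter.\<close>

definition proper_coloring :: "'a set \<Rightarrow> ('a set \<Rightarrow> bool) \<Rightarrow> ('a \<Rightarrow> nat) \<Rightarrow> bool" where
  "proper_coloring E indep c \<longleftrightarrow> (\<forall>j. indep {e \<in> E. c e = j})"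

definition weighted_coloring ::
    "'a set \<Rightarrow> ('a set \<Rightarrow> bool) \<Rightarrow> ('a \<Rightarrow> nat) \<Rightarrow> ('a \<Rightarrow> nat set) \<Rightarrow> bool" where
  "weighted_coloring E indep w W \<longleftrightarrow>
     (\<forall>e\<in>E. W e \<subseteq> {1..} \<and> finite (W e) \<and> card (W e) = w e) \<and>
     (\<forall>c. (\<forall>e\<in>E. c e \<in> W e) \<longrightarrow> proper_coloring E indep c)"

definition colorable_from_lists ::
    "'a set \<Rightarrow> ('a set \<Rightarrow> bool) \<Rightarrow> ('a \<Rightarrow> nat) \<Rightarrow> ('a \<Rightarrow> nat set) \<Rightarrow> bool" where
  "colorable_from_lists E indep w L \<longleftrightarrow>
     (\<exists>W. weighted_coloring E indep w W \<and> (\<forall>e\<in>E. W e \<subseteq> L e))"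

text \<open>A partial play of the on-line game is the list of the rounds played so far, each recorded as
  a pair of Bob's set and Alice's set. Color \<open>i\<close> belongs to round \<open>i\<close>, where rounds are counted
  from 1, hence it is found at list position \<open>i - 1\<close>.\<close>

type_synonym 'a play = "('a set \<times> 'a set) list"

definition current_list :: "'a play \<Rightarrow> 'a \<Rightarrow> nat set" where
  "current_list p e = {i \<in> {1..length p}. e \<in> fst (p ! (i - 1))}"

definition assigned :: "'a play \<Rightarrow> 'a \<Rightarrow> nat set" where
  "assigned p e = {i \<in> {1..length p}. e \<in> snd (p ! (i - 1))}"

definition bob_move :: "'a set \<Rightarrow> ('a \<Rightarrow> nat) \<Rightarrow> 'a play \<Rightarrow> 'a set \<Rightarrow> bool" where
  "bob_move E l p B \<longleftrightarrow> B \<noteq> {} \<and> B \<subseteq> E \<and> (\<forall>e\<in>B. card (current_list p e) < l e)"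

definition alice_move ::
    "('a set \<Rightarrow> bool) \<Rightarrow> ('a \<Rightarrow> nat) \<Rightarrow> 'a play \<Rightarrow> 'a set \<Rightarrow> 'a set \<Rightarrow> bool" where
  "alice_move indep w p B A \<longleftrightarrow> indep A \<and> A \<subseteq> B \<and> (\<forall>e\<in>A. card (assigned p e) < w e)"

definition game_over :: "'a set \<Rightarrow> ('a \<Rightarrow> nat) \<Rightarrow> 'a play \<Rightarrow> bool" where
  "game_over E l p \<longleftrightarrow> (\<forall>e\<in>E. card (current_list p e) = l e)"

text \<open>A strategy of Alice answers Bob's set, given the rounds played before.\<close>

type_synonym 'a strategy = "'a play \<Rightarrow> 'a set \<Rightarrow> 'a set"

inductive play_following :: "'a set \<Rightarrow> ('a \<Rightarrow> nat) \<Rightarrow> 'a strategy \<Rightarrow> 'a play \<Rightarrow> bool"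
  for E :: "'a set" and l :: "'a \<Rightarrow> nat" and s :: "'a strategy" where
  start: "play_following E l s []"
| round: "play_following E l s p \<Longrightarrow> bob_move E l p B \<Longrightarrow> play_following E l s (p @ [(B, s p B)])"

text \<open>Since Bob's sets are non-empty, every play on a finite ground set reaches \<open>game_over\<close>
  after exactly \<open>sum l E\<close> inserted list entries, so it suffices to judge finished plays.\<close>

definition winning_strategy ::
    "'a set \<Rightarrow> ('a set \<Rightarrow> bool) \<Rightarrow> ('a \<Rightarrow> nat) \<Rightarrow> ('a \<Rightarrow> nat) \<Rightarrow> 'a strategy \<Rightarrow> bool" where
  "winning_strategy E indep w l s \<longleftrightarrow>
     (\<forall>p. play_following E l s p \<longrightarrow>
        (\<forall>B. bob_move E l p B \<longrightarrow> alice_move indep w p B (s p B)) \<and>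
        (game_over E l p \<longrightarrow> (\<forall>e\<in>E. card (assigned p e) = w e)))"

definition online_colorable ::
    "'a set \<Rightarrow> ('a set \<Rightarrow> bool) \<Rightarrow> ('a \<Rightarrow> nat) \<Rightarrow> ('a \<Rightarrow> nat) \<Rightarrow> bool" where
  "online_colorable E indep w l \<longleftrightarrow> (\<exists>s. winning_strategy E indep w l s)"

end

theory Submission
  imports Defs
begin

text \<open>Alice maintains independent sets \<open>V 1, V 2, \<dots>\<close> covering each element as often as it still needs
  colors, with \<open>V j\<close> containing only elements that Bob will offer at least \<open>j\<close> more times. When Bob
  plays \<open>B\<close>, the sets are repaired from the highest index down, carrying along an independent set
  \<open>A \<subseteq> B\<close>, at first empty: at index \<open>j\<close> the elements of \<open>V j \<inter> B\<close> with exactly \<open>j\<close> offers left must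
  enter \<open>A\<close>, and by the multiple exchange property some elements of \<open>A\<close> can be traded for them into
  \<open>V j\<close>. Those came from higher indices, so index \<open>j\<close> is still allowed for them. The final \<open>A\<close> is
  Alice's answer.\<close>

section \<open>The rank function and its submodularity\<close>

context matroid
begin

lemma indep_finite: "indep X \<Longrightarrow> finite X"
  using finite_ground finite_subset indep_subset_ground by blast

text \<open>Elements outside \<open>E\<close> may occur in \<open>X\<close> and behave as
  loops.\<close>

definition rank :: "'a set \<Rightarrow> nat" where
  "rank X = Max (card ` {I. indep I \<and> I \<subseteq> X})"

lemma finite_indep_cards: "finite (card ` {I. indep I \<and> I \<subseteq> X})"
proof -
  have "{I. indep I \<and> I \<subseteq> X} \<subseteq> Pow E"
    using indep_subset_ground by auto
  then show ?thesis
    using finite_ground by (meson finite_Pow_iff finite_imageI finite_subset)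
qed

lemma card_le_rank: "indep I \<Longrightarrow> I \<subseteq> X \<Longrightarrow> card I \<le> rank X"
  unfolding rank_def by (rule Max_ge[OF finite_indep_cards]) auto

lemma basis_exists: "\<exists>I. indep I \<and> I \<subseteq> X \<and> card I = rank X"
proof -
  have "card ` {I. indep I \<and> I \<subseteq> X} \<noteq> {}"
    using indep_empty by auto
  from Max_in[OF finite_indep_cards this] show ?thesis
    unfolding rank_def by auto
qed

lemma basis_extends:
  assumes "indep I" "I \<subseteq> X"
  shows "\<exists>J. indep J \<and> I \<subseteq> J \<and> J \<subseteq> X \<and> card J = rank X"
  using assms
proof (induction "rank X - card I" arbitrary: I rule: less_induct)
  case less
  obtain K where K: "indep K" "K \<subseteq> X" "card K = rank X"
    using basis_exists by blast
  show ?case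
  proof (cases "card I < rank X")
    case True
    then obtain e where e: "e \<in> K - I" "indep (insert e I)"
      using augmentation[OF less.prems(1) K(1)] K(3) by auto
    have "card (insert e I) = Suc (card I)"
      using e indep_finite[OF less.prems(1)] by simp
    then have "rank X - card (insert e I) < rank X - card I" "insert e I \<subseteq> X"
      using True e(1) K(2) less.prems(2) by auto
    then obtain J where "indep J" "insert e I \<subseteq> J" "J \<subseteq> X" "card J = rank X"
      using less.hyps e(2) by blast
    then show ?thesis
      by blast
  next
    case False
    then show ?thesis
      using card_le_rank[OF less.prems] less.prems by auto
  qed
qed

lemma rank_le_card: "finite X \<Longrightarrow> rank X \<le> card X"
  using basis_exists[of X] card_mono by metis

lemma indep_if_card_le_rank:
  assumes "finite X" "card X \<le> rank X"
  shows "indep X"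
proof -
  obtain I where "indep I" "I \<subseteq> X" "card I = rank X"
    using basis_exists by blast
  then show ?thesis
    using assms card_seteq by metis
qed

lemma rank_mono: "X \<subseteq> Y \<Longrightarrow> rank X \<le> rank Y"
  using basis_exists[of X] card_le_rank[of _ Y] by (metis subset_trans)

text \<open>Extend a basis \<open>I\<close> of \<open>X \<inter> Y\<close> to a basis
  \<open>J\<close> of \<open>X \<union> Y\<close>. The independent sets \<open>J \<inter> X\<close>
  and \<open>J \<inter> Y\<close> cover \<open>J\<close> and meet in a set containing
  \<open>I\<close>, so counting \<open>J\<close> gives the inequality.\<close>

lemma rank_submodular: "rank (X \<union> Y) + rank (X \<inter> Y) \<le> rank X + rank Y"
proof -
  obtain I where I: "indep I" "I \<subseteq> X \<inter> Y" "card I = rank (X \<inter> Y)"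
    using basis_exists by blast
  obtain J where J: "indep J" "I \<subseteq> J" "J \<subseteq> X \<union> Y" "card J = rank (X \<union> Y)"
    using basis_extends[OF I(1), of "X \<union> Y"] I(2) by blast
  note fin = indep_finite[OF J(1)]
  have "J = (J \<inter> X) \<union> (J \<inter> Y)"
    using J(3) by auto
  then have "rank (X \<union> Y) + card ((J \<inter> X) \<inter> (J \<inter> Y)) = card (J \<inter> X) + card (J \<inter> Y)"
    using card_Un_Int[of "J \<inter> X" "J \<inter> Y"] fin J(4) by simp
  moreover have "rank (X \<inter> Y) \<le> card ((J \<inter> X) \<inter> (J \<inter> Y))"
    unfolding I(3)[symmetric] using I(2) J(2) fin by (intro card_mono) auto
  moreover have "card (J \<inter> X) \<le> rank X" "card (J \<inter> Y) \<le> rank Y"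
    using J(1) indep_subset by (auto intro!: card_le_rank)
  ultimately show ?thesis
    by linarith
qed

lemma rank_insert_le: "rank (insert a X) \<le> Suc (rank X)"
proof -
  have "rank (insert a X) \<le> rank X + rank {a}"
    using rank_submodular[of X "{a}"] by simp
  also have "\<dots> \<le> rank X + 1"
    using rank_le_card[of "{a}"] by simp
  finally show ?thesis
    by simp
qed

section \<open>Matroid partition and multiple exchange\<close>

text \<open>Two-part matroid partition for the contractions by \<open>P\<close> and \<open>Q\<close>. As in Rado's theorem, elements
  of \<open>A\<close> are placed one at a time: if neither side could take \<open>a\<close>, submodularity applied to the two
  violating sets would contradict the rank condition.\<close>

lemma partition_contractions:
  assumes "finite A"
    and "\<And>Z. Z \<subseteq> A \<Longrightarrow> card Z + p + q \<le> rank (Z \<union> P) + rank (Z \<union> Q)"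
    and "rank P \<le> p" "rank Q \<le> q"
  shows "\<exists>C\<subseteq>A. card C + p \<le> rank (C \<union> P) \<and> card (A - C) + q \<le> rank ((A - C) \<union> Q)"
  using assms
proof (induction A arbitrary: P Q p q rule: finite_induct)
  case empty
  \<comment> \<open>\<open>Z = {}\<close> forces \<open>p = rank P\<close> and
    \<open>q = rank Q\<close>, so \<open>C = {}\<close> works.\<close>
  from empty(1)[of "{}"] empty(2,3) show ?case
    by auto
next
  case (insert a A)
  show ?case
  \<comment> \<open>The split asks whether the rank condition survives committing \<open>a\<close>
    to the \<open>P\<close> side, where \<open>P\<close> becomes \<open>insert a P\<close> and
    \<open>p\<close> becomes \<open>Suc p\<close>.\<close>
  proof (cases "\<forall>Z\<subseteq>A. card Z + Suc p + q \<le> rank (Z \<union> insert a P) + rank (Z \<union> Q)")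
    case True
    moreover have "rank (insert a P) \<le> Suc p"
      using rank_insert_le[of a P] insert.prems(2) by linarith
    ultimately obtain C where C: "C \<subseteq> A" "card C + Suc p \<le> rank (C \<union> insert a P)"
      "card (A - C) + q \<le> rank ((A - C) \<union> Q)"
      using insert.IH[of "Suc p" q "insert a P" Q] insert.prems(3) by auto
    have "a \<notin> C" "finite C"
      using C(1) insert.hyps finite_subset by auto
    then have "card (insert a C) + p \<le> rank (insert a C \<union> P)"
      using C(2) by simp
    moreover have "insert a A - insert a C = A - C"
      using insert.hyps by auto
    ultimately show ?thesis
      using C(1,3) by (intro exI[of _ "insert a C"]) auto
  next
    case False
    then obtain Y where Y: "Y \<subseteq> A"
      "rank (Y \<union> insert a P) + rank (Y \<union> Q) \<le> card Y + p + q"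
      by (auto simp: not_le)
    have right: "card Z + p + Suc q \<le> rank (Z \<union> P) + rank (Z \<union> insert a Q)" if "Z \<subseteq> A" for Z
    proof (rule ccontr)
      assume "\<not> ?thesis"
      then have Z: "rank (Z \<union> P) + rank (Z \<union> insert a Q) \<le> card Z + p + q"
        by simp
      \<comment> \<open>\<open>Y\<close> blocks the left side and \<open>Z\<close> the right one.
        Because of \<open>a\<close>, the sizes of \<open>?U\<close> and \<open>?I\<close> add up to
        one more than those of \<open>Y\<close> and \<open>Z\<close>, so the rank condition at
        \<open>?U\<close> and \<open>?I\<close> exceeds by one what submodularity allows.\<close>
      let ?U = "insert a (Y \<union> Z)" and ?I = "Y \<inter> Z"
      have fin: "finite Y" "finite Z" "a \<notin> Y \<union> Z"
        using Y(1) that insert.hyps finite_subset by auto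
      have "rank (?U \<union> P) + rank (?I \<union> P) \<le> rank (Y \<union> insert a P) + rank (Z \<union> P)"
      proof -
        have "rank (?I \<union> P) \<le> rank ((Y \<union> insert a P) \<inter> (Z \<union> P))"
          by (rule rank_mono) auto
        moreover have "(Y \<union> insert a P) \<union> (Z \<union> P) = ?U \<union> P"
          by auto
        ultimately show ?thesis
          using rank_submodular[of "Y \<union> insert a P" "Z \<union> P"] by simp
      qed
      moreover have "rank (?U \<union> Q) + rank (?I \<union> Q) \<le> rank (Y \<union> Q) + rank (Z \<union> insert a Q)"
      proof -
        have "rank (?I \<union> Q) \<le> rank ((Y \<union> Q) \<inter> (Z \<union> insert a Q))"
          by (rule rank_mono) auto
        moreover have "(Y \<union> Q) \<union> (Z \<union> insert a Q) = ?U \<union> Q"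
          by auto
        ultimately show ?thesis
          using rank_submodular[of "Y \<union> Q" "Z \<union> insert a Q"] by simp
      qed
      moreover have "card ?U + p + q \<le> rank (?U \<union> P) + rank (?U \<union> Q)"
        using Y(1) that by (intro insert.prems(1)) auto
      moreover have "card ?I + p + q \<le> rank (?I \<union> P) + rank (?I \<union> Q)"
        using Y(1) by (intro insert.prems(1)) auto
      moreover have "card ?U + card ?I = Suc (card Y + card Z)"
        using fin card_Un_Int[of Y Z] by simp
      ultimately show False
        using Y(2) Z by linarith
    qed
    moreover have "rank (insert a Q) \<le> Suc q"
      using rank_insert_le[of a Q] insert.prems(3) by linarith
    ultimately obtain C where C: "C \<subseteq> A" "card C + p \<le> rank (C \<union> P)"
      "card (A - C) + Suc q \<le> rank ((A - C) \<union> insert a Q)"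
      using insert.IH[of p "Suc q" P "insert a Q"] insert.prems(2) by auto
    have eq: "insert a A - C = insert a (A - C)"
      using C(1) insert.hyps by auto
    have "card (insert a A - C) + q \<le> rank ((insert a A - C) \<union> Q)"
      unfolding eq using C(3) insert.hyps by simp
    then show ?thesis
      using C(1,2) by (intro exI[of _ C]) auto
  qed
qed

text \<open>As \<open>rank (X \<union> Y) \<le> card (X \<union> Y) \<le> card X + card Y\<close>,
  equality holds throughout: nothing is lost to overlap or dependence.\<close>

lemma indep_Un_disjoint_if_rank:
  assumes "finite X" "finite Y" "card X + card Y \<le> rank (X \<union> Y)"
  shows "indep (X \<union> Y) \<and> X \<inter> Y = {}"
proof -
  have "rank (X \<union> Y) \<le> card (X \<union> Y)"
    using assms by (intro rank_le_card) auto
  moreover have "card X + card Y = card (X \<union> Y) + card (X \<inter> Y)"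
    by (rule card_Un_Int) fact+
  ultimately have "card (X \<inter> Y) = 0" "card (X \<union> Y) \<le> rank (X \<union> Y)"
    using assms(3) by linarith+
  then show ?thesis
    using assms(1,2) indep_if_card_le_rank[of "X \<union> Y"] by auto
qed

text \<open>\<open>A\<close> trades \<open>A - C\<close> for \<open>D\<close>. The rank condition
  for partitioning \<open>A\<close> is submodularity for \<open>Z \<union> D\<close> and
  \<open>Z \<union> (X - D)\<close>: their union contains the independent set \<open>X\<close>,
  their intersection the independent set \<open>Z\<close>.\<close>

lemma multiple_exchange:
  assumes "indep A" "indep X" "D \<subseteq> X"
  obtains C where "C \<subseteq> A" "indep (C \<union> D)" "C \<inter> D = {}"
    "indep ((A - C) \<union> (X - D))" "(A - C) \<inter> (X - D) = {}"
proof -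
  have fin: "finite A" "finite X" "finite D"
    using assms indep_finite finite_subset by auto
  have "card Z + card D + card (X - D) \<le> rank (Z \<union> D) + rank (Z \<union> (X - D))" if "Z \<subseteq> A" for Z
  proof -
    have "card X = card D + card (X - D)"
      using fin assms(3) by (simp add: card_Diff_subset card_mono)
    moreover have "card X \<le> rank ((Z \<union> D) \<union> (Z \<union> (X - D)))"
      using assms(2,3) by (intro card_le_rank) auto
    moreover have "card Z \<le> rank ((Z \<union> D) \<inter> (Z \<union> (X - D)))"
      using assms(1) that indep_subset by (intro card_le_rank) auto
    ultimately show ?thesis
      using rank_submodular[of "Z \<union> D" "Z \<union> (X - D)"] by linarith
  qed
  moreover have "rank D \<le> card D" "rank (X - D) \<le> card (X - D)"
    using fin by (auto intro!: rank_le_card)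
  ultimately obtain C where C: "C \<subseteq> A" "card C + card D \<le> rank (C \<union> D)"
    "card (A - C) + card (X - D) \<le> rank ((A - C) \<union> (X - D))"
    using partition_contractions[OF fin(1), of "card D" "card (X - D)" D "X - D"] by auto
  show ?thesis
    using that[OF C(1)] C indep_Un_disjoint_if_rank[of C D]
      indep_Un_disjoint_if_rank[of "A - C" "X - D"] fin finite_subset[OF C(1)] by auto
qed

end

section \<open>Covers by independent sets\<close>

text \<open>Unlike \<^const>\<open>colorable_from_lists\<close>, this is not vacuous when some weight is 0, as happens
  for the remaining weights during the game.\<close>

definition independent_cover ::
    "'a set \<Rightarrow> ('a set \<Rightarrow> bool) \<Rightarrow> ('a \<Rightarrow> nat) \<Rightarrow> ('a \<Rightarrow> nat) \<Rightarrow> (nat \<Rightarrow> 'a set) \<Rightarrow> bool" where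
  "independent_cover E indep w l V \<longleftrightarrow>
     (\<forall>j. indep (V j)) \<and> (\<forall>j. \<forall>e\<in>V j. 1 \<le> j \<and> j \<le> l e) \<and> (\<forall>e\<in>E. card {j. e \<in> V j} = w e)"

lemma independent_cover_if_colorable:
  assumes "\<forall>e\<in>E. 1 \<le> w e" "colorable_from_lists E indep w (\<lambda>e. {1..l e})"
  shows "\<exists>V. independent_cover E indep w l V"
proof -
  obtain W where W: "weighted_coloring E indep w W" "\<forall>e\<in>E. W e \<subseteq> {1..l e}"
    using assms(2) unfolding colorable_from_lists_def by blast
  have card: "\<forall>e\<in>E. card (W e) = w e"
    and proper: "\<And>c. (\<forall>e\<in>E. c e \<in> W e) \<Longrightarrow> proper_coloring E indep c"
    using W(1) unfolding weighted_coloring_def by auto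
  have ne: "W e \<noteq> {}" if "e \<in> E" for e
    using that card assms(1) by fastforce
  have "indep {e \<in> E. j \<in> W e}" for j
  proof -
    \<comment> \<open>\<open>c\<close> takes \<open>j\<close> wherever \<open>W e\<close> allows it,
      so its color class for \<open>j\<close> is all of \<open>{e \<in> E. j \<in> W e}\<close>.
      Elsewhere any member of the non-empty \<open>W e\<close> will do.\<close>
    define c where "c e = (if j \<in> W e then j else SOME i. i \<in> W e)" for e
    have c: "\<forall>e\<in>E. c e \<in> W e"
      unfolding c_def using ne by (auto simp: some_in_eq)
    then have "{e \<in> E. c e = j} = {e \<in> E. j \<in> W e}"
      unfolding c_def by auto
    then show ?thesis
      using proper[OF c] unfolding proper_coloring_def by metis
  qed
  then have "independent_cover E indep w l (\<lambda>j. {e \<in> E. j \<in> W e})"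
    unfolding independent_cover_def using W(2) card by fastforce
  then show ?thesis
    by blast
qed

lemma card_eq_card_Diff_plus:
  assumes "finite S"
  shows "card S = card (S - {x}) + of_bool (x \<in> S)"
  using assms card_Suc_Diff1[of S x] by auto

section \<open>Repairing the cover in one round\<close>

context matroid
begin

text \<open>Here \<open>w\<close> and \<open>l\<close> stand for the colors still needed and the
  offers still to come before Bob plays \<open>B\<close>; \<open>A\<close> is the answer.\<close>

lemma independent_cover_step:
  assumes V: "independent_cover E indep w l V" and B: "B \<subseteq> E"
  obtains A V' where "indep A" "A \<subseteq> B" "\<forall>e\<in>A. 0 < w e"
    "independent_cover E indep (\<lambda>e. w e - of_bool (e \<in> A)) (\<lambda>e. l e - of_bool (e \<in> B)) V'"
proof -
  define N where "N = Max (insert 0 (l ` E))"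
  have N: "l e \<le> N" if "e \<in> E" for e
    unfolding N_def using finite_ground that by (intro Max_ge) auto
  \<comment> \<open>\<open>T n\<close>: indices above \<open>n\<close> already respect the offers
    left after \<open>B\<close>, the others only those before it. Elements of the carried set
    \<open>A\<close> have more than \<open>n\<close> offers, so index \<open>n\<close> stays
    admissible for them after \<open>B\<close>.\<close>
  define T where "T n \<longleftrightarrow> (\<exists>A U. indep A \<and> A \<subseteq> {e \<in> B. n < l e} \<and> (\<forall>j. indep (U j)) \<and>
      (\<forall>j. \<forall>e\<in>U j. 1 \<le> j \<and> j \<le> l e \<and> (n < j \<longrightarrow> j \<le> l e - of_bool (e \<in> B))) \<and>
      (\<forall>e\<in>E. card {j. e \<in> U j} + of_bool (e \<in> A) = w e))" for n
  have ground: "\<And>j. V j \<subseteq> E"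
    using V indep_subset_ground unfolding independent_cover_def by auto
  have "T N"
    unfolding T_def
  proof (intro exI[of _ "{}"] exI[of _ V] conjI)
    show "\<forall>j. \<forall>e\<in>V j. 1 \<le> j \<and> j \<le> l e \<and> (N < j \<longrightarrow> j \<le> l e - of_bool (e \<in> B))"
    proof (intro allI ballI)
      fix j e
      assume e: "e \<in> V j"
      then have "1 \<le> j" "j \<le> l e"
        using V unfolding independent_cover_def by auto
      moreover have "l e \<le> N"
        using e ground N by auto
      ultimately show "1 \<le> j \<and> j \<le> l e \<and> (N < j \<longrightarrow> j \<le> l e - of_bool (e \<in> B))"
        by auto
    qed
  qed (use V indep_empty in \<open>auto simp: independent_cover_def\<close>)
  moreover have "T n" if Suc: "T (Suc n)" for n
  proof -
    obtain A U where A: "indep A" "A \<subseteq> {e \<in> B. Suc n < l e}"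
      and U: "\<And>j. indep (U j)"
        "\<And>j e. e \<in> U j \<Longrightarrow>
          1 \<le> j \<and> j \<le> l e \<and> (Suc n < j \<longrightarrow> j \<le> l e - of_bool (e \<in> B))"
      and cnt: "\<And>e. e \<in> E \<Longrightarrow> card {j. e \<in> U j} + of_bool (e \<in> A) = w e"
      using Suc unfolding T_def by blast
    \<comment> \<open>After the current offer these elements have only \<open>n\<close> offers left,
      so index \<open>Suc n\<close> is lost to them.\<close>
    define D where "D = {e \<in> U (Suc n) \<inter> B. l e = Suc n}"
    have "D \<subseteq> U (Suc n)"
      unfolding D_def by auto
    then obtain C where C: "C \<subseteq> A" "indep (C \<union> D)" "C \<inter> D = {}"
      "indep ((A - C) \<union> (U (Suc n) - D))" "(A - C) \<inter> (U (Suc n) - D) = {}"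
      using multiple_exchange[OF A(1) U(1)] by metis
    define U' where "U' = U(Suc n := (A - C) \<union> (U (Suc n) - D))"
    have "D \<inter> A = {}"
      using A(2) unfolding D_def by auto
    have "indep (U' j)" for j
      using U(1) C(4) unfolding U'_def by simp
    moreover have "1 \<le> j \<and> j \<le> l e \<and> (n < j \<longrightarrow> j \<le> l e - of_bool (e \<in> B))"
      if e: "e \<in> U' j" for j e
    proof (cases "j = Suc n")
      case True
      then consider "e \<in> A" | "e \<in> U (Suc n)" "e \<notin> D"
        using e unfolding U'_def by auto
      then show ?thesis
      proof cases
        case 1
        then show ?thesis
          using A(2) True by auto
      next
        case 2
        then show ?thesis
          using U(2)[of e "Suc n"] True unfolding D_def by auto
      qed
    next
      case False
      then show ?thesis
        using e U(2)[of e j] unfolding U'_def by auto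
    qed
    moreover have "card {j. e \<in> U' j} + of_bool (e \<in> C \<union> D) = w e" if "e \<in> E" for e
    proof -
      let ?S = "{j. e \<in> U j}" and ?S' = "{j. e \<in> U' j}"
      have rest: "?S' - {Suc n} = ?S - {Suc n}"
        unfolding U'_def by auto
      have "?S \<subseteq> {..l e}"
        using U(2) by blast
      then have fin: "finite ?S"
        using finite_subset by blast
      then have "finite (?S' - {Suc n})"
        unfolding rest by simp
      then have fin': "finite ?S'"
        by simp
      \<comment> \<open>Only set number \<open>Suc n\<close> and the carried set change:
        \<open>A - C\<close> moves in, \<open>D\<close> moves out, and disjointness excludes double
        entries.\<close>
      have "of_bool (Suc n \<in> ?S') + of_bool (e \<in> C \<union> D) =
          (of_bool (Suc n \<in> ?S) + of_bool (e \<in> A) :: nat)"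
        using C(1,3,5) \<open>D \<subseteq> U (Suc n)\<close> \<open>D \<inter> A = {}\<close> unfolding U'_def
        by (cases "e \<in> A"; cases "e \<in> C"; cases "e \<in> D"; cases "e \<in> U (Suc n)") auto
      then show ?thesis
        using card_eq_card_Diff_plus[OF fin, of "Suc n"]
          card_eq_card_Diff_plus[OF fin', of "Suc n"] rest cnt[OF that] by simp
    qed
    moreover have "C \<union> D \<subseteq> {e \<in> B. n < l e}"
      using A(2) C(1) unfolding D_def by auto
    ultimately show ?thesis
      unfolding T_def using C(2) by (intro exI[of _ "C \<union> D"] exI[of _ U']) blast
  qed
  \<comment> \<open>The repair runs down from \<open>N\<close>. At \<open>0\<close> it is complete,
    since occupied indices are at least 1.\<close>
  ultimately have "T 0"
    using inc_induct[of 0 N T] by blast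
  then obtain A U where A: "indep A" "A \<subseteq> {e \<in> B. 0 < l e}" and U: "\<forall>j. indep (U j)"
    "\<forall>j. \<forall>e\<in>U j. 1 \<le> j \<and> j \<le> l e \<and> (0 < j \<longrightarrow> j \<le> l e - of_bool (e \<in> B))"
    and cnt: "\<forall>e\<in>E. card {j. e \<in> U j} + of_bool (e \<in> A) = w e"
    unfolding T_def by blast
  have "independent_cover E indep (\<lambda>e. w e - of_bool (e \<in> A)) (\<lambda>e. l e - of_bool (e \<in> B)) U"
    unfolding independent_cover_def
  proof (intro conjI ballI allI)
    show "card {j. e \<in> U j} = w e - of_bool (e \<in> A)" if "e \<in> E" for e
      using bspec[OF cnt that] by linarith
    fix j e
    assume "e \<in> U j"
    then show "1 \<le> j" "j \<le> l e - of_bool (e \<in> B)"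
      using U(2) by (metis less_le_trans zero_less_one)+
  qed (use U(1) in simp)
  moreover have "\<forall>e\<in>A. 0 < w e"
  proof
    fix e
    assume e: "e \<in> A"
    then show "0 < w e"
      using bspec[OF cnt, of e] A(2) B by auto
  qed
  ultimately show ?thesis
    using that[of A U] A by auto
qed

end

section \<open>Plays and the winning strategy\<close>

lemma current_list_snoc:
  "current_list (p @ [(B, A)]) e = current_list p e \<union> (if e \<in> B then {Suc (length p)} else {})"
  unfolding current_list_def by (auto simp: nth_append le_Suc_eq)

lemma assigned_snoc:
  "assigned (p @ [(B, A)]) e = assigned p e \<union> (if e \<in> A then {Suc (length p)} else {})"
  unfolding assigned_def by (auto simp: nth_append le_Suc_eq)

lemma card_current_list_snoc:
  "card (current_list (p @ [(B, A)]) e) = card (current_list p e) + of_bool (e \<in> B)"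
  unfolding current_list_snoc by (simp add: current_list_def)

lemma card_assigned_snoc:
  "card (assigned (p @ [(B, A)]) e) = card (assigned p e) + of_bool (e \<in> A)"
  unfolding assigned_snoc by (simp add: assigned_def)

theorem theorem6:
  fixes E :: "'a set" and indep :: "'a set \<Rightarrow> bool" and w l :: "'a \<Rightarrow> nat"
  assumes "matroid E indep"
    and "\<forall>e\<in>E. 1 \<le> w e"
    and "\<forall>e\<in>E. 1 \<le> l e"
    and "colorable_from_lists E indep w (\<lambda>e. {1..l e})"
  shows "online_colorable E indep w l"
proof -
  interpret matroid E indep
    by fact
  \<comment> \<open>The bound is stated separately because truncated subtraction would hide an
    excess of assigned colors.\<close>
  define good where "good p \<longleftrightarrow> (\<forall>e\<in>E. card (assigned p e) \<le> w e) \<and>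
      (\<exists>V. independent_cover E indep (\<lambda>e. w e - card (assigned p e))
        (\<lambda>e. l e - card (current_list p e)) V)" for p
  define s where
    "s p B = (SOME A. alice_move indep w p B A \<and> good (p @ [(B, A)]))" for p B
  have answer: "alice_move indep w p B (s p B) \<and> good (p @ [(B, s p B)])"
    if "good p" "bob_move E l p B" for p B
  proof -
    obtain V where V: "independent_cover E indep (\<lambda>e. w e - card (assigned p e))
        (\<lambda>e. l e - card (current_list p e)) V"
      and le: "\<forall>e\<in>E. card (assigned p e) \<le> w e"
      using \<open>good p\<close> unfolding good_def by blast
    have B: "B \<subseteq> E"
      using that(2) unfolding bob_move_def by blast
    obtain A V' where A: "indep A" "A \<subseteq> B" "\<forall>e\<in>A. 0 < w e - card (assigned p e)"
      and V': "independent_cover E indep (\<lambda>e. w e - card (assigned p e) - of_bool (e \<in> A))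
        (\<lambda>e. l e - card (current_list p e) - of_bool (e \<in> B)) V'"
      by (rule independent_cover_step[OF V B])
    have "alice_move indep w p B A"
      using A unfolding alice_move_def by auto
    moreover have "good (p @ [(B, A)])"
      unfolding good_def card_assigned_snoc card_current_list_snoc
    proof (intro conjI exI)
      show "independent_cover E indep (\<lambda>e. w e - (card (assigned p e) + of_bool (e \<in> A)))
          (\<lambda>e. l e - (card (current_list p e) + of_bool (e \<in> B))) V'"
        using V' by simp
      show "\<forall>e\<in>E. card (assigned p e) + of_bool (e \<in> A) \<le> w e"
        using le A(3) by (auto simp: Suc_le_eq)
    qed
    ultimately have "\<exists>A. alice_move indep w p B A \<and> good (p @ [(B, A)])"
      by blast
    then show ?thesis
      unfolding s_def by (rule someI_ex)
  qed
  have good: "good p" if "play_following E l s p" for p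
    using that
  proof induction
    case start
    have "assigned [] e = {}" "current_list [] e = {}" for e :: 'a
      unfolding assigned_def current_list_def by simp_all
    then show ?case
      using independent_cover_if_colorable[OF assms(2,4)] unfolding good_def by simp
  next
    case (round p B)
    show ?case
      using answer[OF round.IH round.hyps(2)] by simp
  qed
  have "card (assigned p e) = w e"
    if play: "play_following E l s p" and over: "game_over E l p" and e: "e \<in> E" for p e
  proof -
    obtain V where V: "independent_cover E indep (\<lambda>e. w e - card (assigned p e))
        (\<lambda>e. l e - card (current_list p e)) V"
      and "card (assigned p e) \<le> w e"
      using good[OF play] e unfolding good_def by blast
    moreover have "l e - card (current_list p e) = 0"
      using over e unfolding game_over_def by simp
    \<comment> \<open>No index satisfies \<open>1 \<le> j \<le> 0\<close>, so \<open>e\<close> lies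
      in no set and its remaining weight is 0.\<close>
    then have "{j. e \<in> V j} = {}"
      using V unfolding independent_cover_def by fastforce
    ultimately show ?thesis
      using e unfolding independent_cover_def by fastforce
  qed
  then have "winning_strategy E indep w l s"
    unfolding winning_strategy_def using answer[OF good] by simp
  then show ?thesis
    unfolding online_colorable_def by blast
qed

end
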